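(* Let $f:\mathbb{R}^N\to\mathbb{R}$ be convex and differentiable. Let $\hat S$ be an arbitrary proper sampling with probability vector $p=(p_1,\dots,p_n)$ and let $v\in\mathbb{R}^n_{++}$ be such that $(f,\hat S)\sim ESO(v)$. Choose $\theta_0\in(0,1]$ and define $\{\theta_k\}_{k\ge0}$ by $$\theta_{k+1}=\frac{\sqrt{\theta_k^4+4\theta_k^2}-\theta_k^2}{2}.$$ For $y\in\mathbb{R}^N$ let $$C=(1-\theta_0)\big(f(x_0)-f(y)\big)+\frac{\theta_0^2}{2}\|x_0-y\|^2_{v\circ p^{-2}}.$$ Then for any $y\in\mathbb{R}^N$ such that $C\ge0$, the iterates $\{x_k\}_{k\ge1}$ of the smooth ALPHA algorithm satisfy, for all $k\ge1$, $$\mathbf{E}[f(x_k)]-f(y)\le\frac{4C}{((k-1)\theta_0+2)^2}.$$ In particular, if $\theta_0=1$, then for all $k\ge1$, $$\mathbf{E}[f(x_k)]-f(y)\le\frac{2\|x_0-y\|^2_{v\circ p^{-2}}}{(k+1)^2}=\frac{2\sum_{i=1}^n\frac{v_i}{p_i^2}\|x_0^i-y^i\|_i^2}{(k+1)^2}.$$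
   Context: Block structure: $\mathbb{R}^N=\mathbb{R}^{N_1}\times\dots\times\mathbb{R}^{N_n}$, $[n]=\{1,\dots,n\}$; $x^i\in\mathbb{R}^{N_i}$ is the $i$th block of $x\in\mathbb{R}^N$, and $U_i$ is the $N\times N_i$ column submatrix of the identity with $x^i=U_i^\top x$. For $S\subseteq[n]$, $h_{[S]}=\sum_{i\in S}U_ih^i$. $\nabla_i f(x)=U_i^\top\nabla f(x)$. $\langle\cdot,\cdot\rangle$ is the standard inner product. For each $i$, $B_i$ is a fixed (symmetric) positive definite $N_i\times N_i$ matrix and $\|x^i\|_i^2=\langle B_ix^i,x^i\rangle$. For $w\in\mathbb{R}^n_{++}$ (vectors with positive entries): $\langle x,y\rangle_w=\sum_i w_i\langle x^i,y^i\rangle$ and $\|x\|_w^2=\sum_i w_i\|x^i\|_i^2$. For vectors in $\mathbb{R}^n$: $\circ$ is the elementwise product, and $p^{-1},p^{-2}$ are elementwise powers. For $u\in\mathbb{R}^n$, $x\in\mathbb{R}^N$: $u\cdot x=\sum_i u_iU_ix^i$. Sampling: a sampling $\hat S$ is a random subset of $[n]$; $p_i=\mathrm{Prob}(i\in\hat S)$; it is proper if $p_i>0$ for all $i$. ESO: $(f,\hat S)\sim ESO(v)$ means that for all $x,h\in\mathbb{R}^N$, $\mathbf{E}[f(x+h_{[\hat S]})]\le f(x)+\langle\nabla f(x),h\rangle_p+\frac12\|h\|^2_{v\circ p}$. Smooth ALPHA algorithm (parameters $\hat S,v,\{\theta_k\}_{k\ge0}$): choose $x_0\in\mathbb{R}^N$,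 set $z_0=x_0$. For $k\ge0$: $y_k=(1-\theta_k)x_k+\theta_kz_k$; draw a random set $S_k$ with the distribution of $\hat S$, independently of the past; set $z_{k+1}^i=z_k^i-\frac{p_i}{v_i\theta_k}B_i^{-1}\nabla_if(y_k)$ for $i\in S_k$ and $z_{k+1}^i=z_k^i$ for $i\notin S_k$; set $x_{k+1}=y_k+\theta_kp^{-1}\cdot(z_{k+1}-z_k)$. *)

theory Defs
  imports "HOL-Analysis.Analysis" "HOL-Probability.Probability"
begin

text \<open>
  Coordinates of the ambient space are indexed by the finite type \<open>'m\<close>, blocks by the finite
  type \<open>'n\<close>, and \<open>blk j\<close> is the block to which the coordinate \<open>j\<close> belongs, so that the
  dimension of block \<open>i\<close> is the cardinality of \<open>{j. blk j = i}\<close>. As block dimensions differ,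
  the block \<open>x\<^sup>i\<close> is represented by its zero-padded version \<open>U\<^sub>i x\<^sup>i\<close>, and a square matrix
  \<open>A\<close> acting on block \<open>i\<close> by its zero-padded version \<open>U\<^sub>i A U\<^sub>i\<^sup>T\<close>. Padding preserves
  sums, scalar multiples, inner products and matrix products.
\<close>

definition block :: "('m \<Rightarrow> 'n) \<Rightarrow> 'n \<Rightarrow> real^'m \<Rightarrow> real^'m::finite" where
  "block blk i x = (\<chi> j. if blk j = i then x $ j else 0)"

definition block_sum :: "('m \<Rightarrow> 'n) \<Rightarrow> 'n set \<Rightarrow> real^'m \<Rightarrow> real^'m::finite" where
  "block_sum blk S h = (\<Sum>i\<in>S. block blk i h)"

definition block_scale :: "('m \<Rightarrow> 'n) \<Rightarrow> real^'n \<Rightarrow> real^'m::finite \<Rightarrow> real^'m" where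
  "block_scale blk u x = (\<Sum>i\<in>UNIV. (u $ i) *\<^sub>R block blk i x)"

definition block_supported :: "('m \<Rightarrow> 'n) \<Rightarrow> 'n \<Rightarrow> real^'m^'m::finite \<Rightarrow> bool" where
  "block_supported blk i A \<longleftrightarrow> (\<forall>j l. blk j \<noteq> i \<or> blk l \<noteq> i \<longrightarrow> A $ j $ l = 0)"

definition block_posdef :: "('m \<Rightarrow> 'n) \<Rightarrow> 'n \<Rightarrow> real^'m^'m::finite \<Rightarrow> bool" where
  "block_posdef blk i A \<longleftrightarrow> block_supported blk i A \<and> transpose A = A \<and>
     (\<forall>x. block blk i x \<noteq> 0 \<longrightarrow> (A *v block blk i x) \<bullet> block blk i x > 0)"

definition block_id :: "('m \<Rightarrow> 'n) \<Rightarrow> 'n \<Rightarrow> real^'m^'m::finite" where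
  "block_id blk i = (\<chi> j l. if j = l \<and> blk j = i then 1 else 0)"

text \<open>The padded inverse of a block matrix; compare \<^const>\<open>matrix_inv\<close>.\<close>

definition block_inv :: "('m \<Rightarrow> 'n) \<Rightarrow> 'n \<Rightarrow> real^'m^'m::finite \<Rightarrow> real^'m^'m" where
  "block_inv blk i A = (SOME A'. block_supported blk i A' \<and>
     A ** A' = block_id blk i \<and> A' ** A = block_id blk i)"

definition block_norm_sq :: "('m \<Rightarrow> 'n) \<Rightarrow> ('n \<Rightarrow> real^'m^'m) \<Rightarrow> 'n \<Rightarrow> real^'m::finite \<Rightarrow> real" where
  "block_norm_sq blk B i x = (B i *v block blk i x) \<bullet> block blk i x"

definition weighted_inner :: "('m \<Rightarrow> 'n) \<Rightarrow> real^'n \<Rightarrow> real^'m::finite \<Rightarrow> real^'m \<Rightarrow> real" where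
  "weighted_inner blk w x y = (\<Sum>i\<in>UNIV. w $ i * (block blk i x \<bullet> block blk i y))"

definition weighted_norm_sq ::
  "('m \<Rightarrow> 'n) \<Rightarrow> ('n \<Rightarrow> real^'m^'m) \<Rightarrow> real^'n \<Rightarrow> real^'m::finite \<Rightarrow> real" where
  "weighted_norm_sq blk B w x = (\<Sum>i\<in>UNIV. w $ i * block_norm_sq blk B i x)"

text \<open>Elementwise powers; the elementwise product is the multiplication of type \<open>real^'n\<close>.\<close>

definition vec_powi :: "real^'n \<Rightarrow> int \<Rightarrow> real^'n" where
  "vec_powi p k = (\<chi> i. p $ i powi k)"

definition gradient :: "('a::real_inner \<Rightarrow> real) \<Rightarrow> 'a \<Rightarrow> 'a" where
  "gradient f x = (THE D. GDERIV f x :> D)"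

text \<open>A sampling is a distribution on the (finitely many) subsets of the block index type.\<close>

definition sampling_prob :: "'n::finite set pmf \<Rightarrow> real^'n" where
  "sampling_prob Shat = (\<chi> i. measure_pmf.prob Shat {A. i \<in> A})"

definition proper_sampling :: "'n::finite set pmf \<Rightarrow> bool" where
  "proper_sampling Shat \<longleftrightarrow> (\<forall>i. sampling_prob Shat $ i > 0)"

definition ESO :: "('m \<Rightarrow> 'n) \<Rightarrow> ('n \<Rightarrow> real^'m^'m) \<Rightarrow> (real^'m::finite \<Rightarrow> real) \<Rightarrow>
    'n::finite set pmf \<Rightarrow> real^'n \<Rightarrow> bool" where
  "ESO blk B f Shat v \<longleftrightarrow> (\<forall>x h.
     measure_pmf.expectation Shat (\<lambda>S. f (x + block_sum blk S h))
       \<le> f x + weighted_inner blk (sampling_prob Shat) (gradient f x) h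
           + 1/2 * weighted_norm_sq blk B (v * sampling_prob Shat) h)"

text \<open>
  One iteration of the method from \<open>(x\<^sub>k, z\<^sub>k)\<close> to \<open>(x\<^sub>k\<^sub>+\<^sub>1, z\<^sub>k\<^sub>+\<^sub>1)\<close>, with \<open>t = \<theta>\<^sub>k\<close> and \<open>S = S\<^sub>k\<close>.
\<close>

definition alpha_step :: "('m \<Rightarrow> 'n) \<Rightarrow> ('n \<Rightarrow> real^'m^'m) \<Rightarrow> (real^'m::finite \<Rightarrow> real) \<Rightarrow>
    real^'n \<Rightarrow> real^'n::finite \<Rightarrow> real \<Rightarrow> 'n set \<Rightarrow> (real^'m) \<times> (real^'m) \<Rightarrow> (real^'m) \<times> (real^'m)" where
  "alpha_step blk B f p v t S = (\<lambda>(x, z).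
     let y = (1 - t) *\<^sub>R x + t *\<^sub>R z;
         z' = (\<Sum>i\<in>UNIV. if i \<in> S
                 then block blk i z
                        - (p $ i / (v $ i * t)) *\<^sub>R (block_inv blk i (B i) *v block blk i (gradient f y))
                 else block blk i z);
         x' = y + t *\<^sub>R block_scale blk (vec_powi p (-1)) (z' - z)
     in (x', z'))"

text \<open>The pair \<open>(x\<^sub>k, z\<^sub>k)\<close> along the realisation \<open>S 0, S 1, \<dots>\<close> of the random sets.\<close>

primrec alpha_state :: "('m \<Rightarrow> 'n) \<Rightarrow> ('n \<Rightarrow> real^'m^'m) \<Rightarrow> (real^'m::finite \<Rightarrow> real) \<Rightarrow>
    real^'n \<Rightarrow> real^'n::finite \<Rightarrow> (nat \<Rightarrow> real) \<Rightarrow> real^'m \<Rightarrow> (nat \<Rightarrow> 'n set) \<Rightarrow> nat \<Rightarrow>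
    (real^'m) \<times> (real^'m)" where
  "alpha_state blk B f p v \<theta> x0 S 0 = (x0, x0)"
| "alpha_state blk B f p v \<theta> x0 S (Suc k) =
     alpha_step blk B f p v (\<theta> k) (S k) (alpha_state blk B f p v \<theta> x0 S k)"

definition alpha_x :: "('m \<Rightarrow> 'n) \<Rightarrow> ('n \<Rightarrow> real^'m^'m) \<Rightarrow> (real^'m::finite \<Rightarrow> real) \<Rightarrow>
    real^'n \<Rightarrow> real^'n::finite \<Rightarrow> (nat \<Rightarrow> real) \<Rightarrow> real^'m \<Rightarrow> (nat \<Rightarrow> 'n set) \<Rightarrow> nat \<Rightarrow> real^'m" where
  "alpha_x blk B f p v \<theta> x0 S k = fst (alpha_state blk B f p v \<theta> x0 S k)"

text \<open>The description operators above denote the intended objects.\<close>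

lemma gradient_eqI: "gradient f x = D" if "GDERIV f x :> D"
proof -
  have "D' = D" if "GDERIV f x :> D'" for D'
  proof -
    have "(\<lambda>h. h \<bullet> D') = (\<lambda>h. h \<bullet> D)"
      using that \<open>GDERIV f x :> D\<close> has_derivative_unique unfolding gderiv_def by blast
    then have "(D' - D) \<bullet> D' = (D' - D) \<bullet> D" by metis
    then have "(D' - D) \<bullet> (D' - D) = 0" by (simp add: inner_diff_right)
    then show ?thesis by simp
  qed
  then show ?thesis unfolding gradient_def using that by blast
qed

lemma GDERIV_gradient: "GDERIV f x :> gradient f x"
  if "f differentiable at x" for f :: "'a::euclidean_space \<Rightarrow> real"
proof -
  obtain f' where f': "(f has_derivative f') (at x)"
    using \<open>f differentiable at x\<close> unfolding differentiable_def by blast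
  have lin: "linear f'" using f' by (rule has_derivative_linear)
  have "f' h = h \<bullet> (\<Sum>b\<in>Basis. f' b *\<^sub>R b)" for h
  proof -
    have "f' h = f' (\<Sum>b\<in>Basis. (h \<bullet> b) *\<^sub>R b)" by (simp add: euclidean_representation)
    also have "\<dots> = (\<Sum>b\<in>Basis. (h \<bullet> b) * f' b)"
      by (simp add: linear_sum[OF lin] linear_scale[OF lin])
    also have "\<dots> = h \<bullet> (\<Sum>b\<in>Basis. f' b *\<^sub>R b)"
      by (simp add: inner_sum_right mult.commute)
    finally show ?thesis .
  qed
  then have "f' = (\<lambda>h. h \<bullet> (\<Sum>b\<in>Basis. f' b *\<^sub>R b))" by (rule ext)
  then have "GDERIV f x :> (\<Sum>b\<in>Basis. f' b *\<^sub>R b)"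
    using f' unfolding gderiv_def by simp
  then show ?thesis using gradient_eqI by metis
qed

lemma block_id_mult_vec: "block_id blk i *v x = block blk i x"
  by (vector block_id_def block_def matrix_vector_mult_def)
     (auto simp: if_distrib if_distribR sum.If_cases cong: if_cong)

lemma block_id_mult_left:
  "(block_id blk i ** A) $ j $ l = (if blk j = i then A $ j $ l else 0)"
proof -
  have "(block_id blk i ** A) $ j $ l = (\<Sum>k\<in>UNIV. if j = k then (if blk j = i then A $ k $ l else 0) else 0)"
    unfolding matrix_matrix_mult_def block_id_def vec_lambda_beta
    by (rule sum.cong) simp_all
  then show ?thesis by simp
qed

lemma block_id_mult_right:
  "(A ** block_id blk i) $ j $ l = (if blk l = i then A $ j $ l else 0)"
proof -
  have "(A ** block_id blk i) $ j $ l = (\<Sum>k\<in>UNIV. if k = l then (if blk l = i then A $ j $ k else 0) else 0)"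
    unfolding matrix_matrix_mult_def block_id_def vec_lambda_beta
    by (rule sum.cong) simp_all
  then show ?thesis by simp
qed

lemma block_inv:
  fixes A :: "real^'m^'m::finite"
  assumes "block_posdef blk i A"
  shows "block_supported blk i (block_inv blk i A)"
    and "A ** block_inv blk i A = block_id blk i"
    and "block_inv blk i A ** A = block_id blk i"
proof -
  let ?P = "block_id blk i"
  define M where "M = A + (mat 1 - ?P)"
  have supp: "block_supported blk i A" and
    pos: "\<And>x. block blk i x \<noteq> 0 \<Longrightarrow> (A *v block blk i x) \<bullet> block blk i x > 0"
    using assms unfolding block_posdef_def by auto
  have PA: "?P ** A = A" and AP: "A ** ?P = A"
    using supp unfolding block_supported_def
    by (auto simp: vec_eq_iff block_id_mult_left block_id_mult_right)
  have PP: "?P ** ?P = ?P"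
    by (simp add: vec_eq_iff block_id_mult_left) (simp add: block_id_def)
  have PM: "?P ** M = A" and MP: "M ** ?P = A"
    unfolding M_def
    by (simp_all add: vec_eq_iff block_id_mult_left block_id_mult_right)
       (use supp in \<open>auto simp: block_supported_def mat_def block_id_def\<close>)
  have "x = 0" if "M *v x = 0" for x
  proof -
    have "A *v x = 0"
      by (metis PM matrix_vector_mul_assoc matrix_vector_mult_0_right that)
    then have "(A *v block blk i x) = 0"
      by (metis AP block_id_mult_vec matrix_vector_mul_assoc)
    then have b: "block blk i x = 0" using pos by fastforce
    have "M *v x = A *v x + (x - block blk i x)"
      unfolding M_def
      by (simp add: matrix_vector_mult_add_rdistrib matrix_vector_mult_diff_rdistrib block_id_mult_vec)
    then show ?thesis using that b \<open>A *v x = 0\<close> by simp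
  qed
  then obtain N where NM: "N ** M = mat 1"
    using matrix_left_invertible_ker[of M] by blast
  then have MN: "M ** N = mat 1" using matrix_left_right_inverse by blast
  have NA: "N ** A = ?P" by (metis MP NM matrix_mul_assoc matrix_mul_lid)
  have AN: "A ** N = ?P" by (metis PM MN matrix_mul_assoc matrix_mul_rid)
  have PN: "?P ** N = N ** ?P" by (metis NA AN matrix_mul_assoc)
  have "block_supported blk i (?P ** N)"
    unfolding block_supported_def
    by (auto simp: block_id_mult_left) (metis PN block_id_mult_left block_id_mult_right)
  moreover have "A ** (?P ** N) = ?P" by (simp add: matrix_mul_assoc AP AN)
  moreover have "(?P ** N) ** A = ?P" by (simp add: matrix_mul_assoc[symmetric] NA PP)
  ultimately have "\<exists>A'. block_supported blk i A' \<and> A ** A' = ?P \<and> A' ** A = ?P" by blast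
  from someI_ex[OF this] show "block_supported blk i (block_inv blk i A)"
    "A ** block_inv blk i A = ?P" "block_inv blk i A ** A = ?P"
    unfolding block_inv_def by blast+
qed

end

theory Submission
  imports Defs
begin

text \<open>
  Fix \<open>y\<close> and write \<open>N u = \<parallel>u\<parallel>\<^sup>2\<close> for the norm with weights \<open>v \<circ> p\<^sup>-\<^sup>2\<close>. The proof rests on the fact
  that the potential
  \<open>\<Psi>\<^sub>k = (1 - \<theta>\<^sub>k) / \<theta>\<^sub>k\<^sup>2 \<cdot> (f x\<^sub>k - f y) + N (z\<^sub>k - y) / 2\<close>
  does not increase in expectation.

  For one step, let \<open>w\<close> be the extrapolated point \<open>y\<^sub>k\<close> of the method, \<open>g\<close> its gradient and \<open>d\<close> the
  full direction with blocks \<open>d\<^sub>i = p\<^sub>i / (v\<^sub>i \<theta>) \<cdot> B\<^sub>i\<^sup>-\<^sup>1 g\<^sub>i\<close>. The step moves \<open>z\<close> by the part of \<open>- d\<close> on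
  the drawn blocks, and the new \<open>x\<close> is \<open>w\<close> plus the part of \<open>- \<theta> p\<^sup>-\<^sup>1 \<cdot> d\<close> on the drawn blocks. Both
  effects are governed by \<open>\<langle>g, d\<rangle>\<close>: the ESO inequality gives \<open>E f x' \<le> f w - \<theta>/2 \<langle>g, d\<rangle>\<close>, while
  taking the expectation block by block gives
  \<open>\<theta>\<^sup>2/2 E N (z' - y) = \<theta>\<^sup>2/2 N (z - y) + \<theta>/2 \<langle>g, d\<rangle> - \<theta> \<langle>g, z - y\<rangle>\<close>. The weights \<open>v \<circ> p\<^sup>-\<^sup>2\<close> and the
  scaling by \<open>p\<^sup>-\<^sup>1\<close> are those for which the two multiples of \<open>\<langle>g, d\<rangle>\<close> cancel. As
  \<open>\<theta> (y - z) = \<theta> (y - w) + (1 - \<theta>) (x - w)\<close>, what is left is bounded by convexity at the two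
  points \<open>y\<close> and \<open>x\<close>; this is \<open>alpha_step_expected_decrease\<close>.

  The recurrence for \<open>\<theta>\<close> says that \<open>(1 - \<theta>\<^sub>k\<^sub>+\<^sub>1) / \<theta>\<^sub>k\<^sub>+\<^sub>1\<^sup>2 = 1 / \<theta>\<^sub>k\<^sup>2\<close>, which makes the one-step bound
  divided by \<open>\<theta>\<^sub>k\<^sup>2\<close> telescope. Hence \<open>(E f x\<^sub>k\<^sub>+\<^sub>1 - f y) / \<theta>\<^sub>k\<^sup>2 \<le> E \<Psi>\<^sub>k\<^sub>+\<^sub>1 \<le> \<Psi>\<^sub>0 = C / \<theta>\<^sub>0\<^sup>2\<close>. The same
  recurrence yields \<open>1 / \<theta>\<^sub>k\<^sub>+\<^sub>1 \<ge> 1 / \<theta>\<^sub>k + 1/2\<close>, hence the rate (\<open>stepsize_recurrence\<close>).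

  As each iterate takes only finitely many values, conditioning on the past reduces to splitting
  an expectation over the values of the fresh random set (\<open>expectation_indep_pmf\<close>).
\<close>

section \<open>The gradient inequality for convex functions\<close>

text \<open>Restricting \<open>f\<close> to the line through \<open>a\<close> and \<open>x\<close> reduces this to the tangent inequality
  for convex functions of one real variable.\<close>

lemma convex_above_gradient:
  fixes f :: "'a::euclidean_space \<Rightarrow> real"
  assumes "convex_on UNIV f" and "f differentiable at a"
  shows "f a + gradient f a \<bullet> (x - a) \<le> f x"
proof -
  define \<phi> where "\<phi> s = f (a + s *\<^sub>R (x - a))" for s :: real
  have "convex_on UNIV \<phi>"
  proof (rule convex_onI)
    fix t r s :: real
    assume t: "0 < t" "t < 1"
    have "a + ((1 - t) * r + t * s) *\<^sub>R (x - a)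
        = (1 - t) *\<^sub>R (a + r *\<^sub>R (x - a)) + t *\<^sub>R (a + s *\<^sub>R (x - a))"
      by (simp add: algebra_simps)
    then show "\<phi> ((1 - t) *\<^sub>R r + t *\<^sub>R s) \<le> (1 - t) * \<phi> r + t * \<phi> s"
      using convex_onD[OF assms(1), of t "a + r *\<^sub>R (x - a)" "a + s *\<^sub>R (x - a)"] t
      unfolding \<phi>_def by simp
  qed simp
  moreover have "(\<phi> has_field_derivative gradient f a \<bullet> (x - a)) (at 0)"
  proof -
    have "(f has_derivative (\<lambda>h. h \<bullet> gradient f a)) (at (a + 0 *\<^sub>R (x - a)))"
      using GDERIV_gradient[OF assms(2)] by (simp add: gderiv_def)
    moreover have "((\<lambda>s::real. a + s *\<^sub>R (x - a)) has_derivative (\<lambda>s. s *\<^sub>R (x - a))) (at 0)"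
      by (auto intro!: derivative_eq_intros)
    ultimately have "(\<phi> has_derivative (\<lambda>s. (s *\<^sub>R (x - a)) \<bullet> gradient f a)) (at 0)"
      unfolding \<phi>_def by (rule has_derivative_compose[rotated])
    then show ?thesis
      by (simp add: has_field_derivative_def inner_commute mult_commute_abs)
  qed
  ultimately have "\<phi> 1 - \<phi> 0 \<ge> gradient f a \<bullet> (x - a) * (1 - 0)"
    by (intro convex_on_imp_above_tangent[where A = UNIV]) auto
  then show ?thesis by (simp add: \<phi>_def)
qed

section \<open>Calculus of blocks\<close>

lemma block_nth: "block blk i x $ j = (if blk j = i then x $ j else 0)"
  by (simp add: block_def)

lemma block_linear:
  "block blk i (x + y) = block blk i x + block blk i y"
  "block blk i (x - y) = block blk i x - block blk i y"
  "block blk i (- x) = - block blk i x"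
  "block blk i (c *\<^sub>R x) = c *\<^sub>R block blk i x"
  "block blk i 0 = 0"
  by (simp_all add: vec_eq_iff block_nth)

lemma block_block: "block blk i (block blk k x) = (if k = i then block blk i x else 0)"
  by (simp add: vec_eq_iff block_nth)

lemma block_sum_of_blocks:
  assumes "finite S"
  shows "block blk i (\<Sum>k\<in>S. block blk k (u k)) = (if i \<in> S then block blk i (u i) else 0)"
proof -
  have "block blk i (\<Sum>k\<in>S. block blk k (u k)) = (\<Sum>k\<in>S. block blk i (block blk k (u k)))"
    using assms by (induction S rule: finite_induct) (simp_all add: block_linear)
  then show ?thesis using assms by (simp add: block_block)
qed

lemma sum_of_blocks:
  fixes blk :: "'m::finite \<Rightarrow> 'n::finite"
  shows "(\<Sum>i\<in>UNIV. block blk i x) = x"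
  by (simp add: vec_eq_iff block_nth)

lemma eq_by_blocks:
  fixes blk :: "'m::finite \<Rightarrow> 'n::finite"
  assumes "\<And>i. block blk i x = block blk i y"
  shows "x = y"
proof -
  have "(\<Sum>i\<in>UNIV. block blk i x) = (\<Sum>i\<in>UNIV. block blk i y)"
    using assms by simp
  then show ?thesis by (simp only: sum_of_blocks)
qed

lemma inner_by_blocks:
  fixes blk :: "'m::finite \<Rightarrow> 'n::finite"
  shows "(\<Sum>i\<in>UNIV. block blk i x \<bullet> block blk i y) = x \<bullet> y"
proof -
  have "block blk i x \<bullet> block blk i y = block blk i x \<bullet> y" for i
    unfolding inner_vec_def by (rule sum.cong) (auto simp: block_nth)
  then have "(\<Sum>i\<in>UNIV. block blk i x \<bullet> block blk i y) = (\<Sum>i\<in>UNIV. block blk i x) \<bullet> y"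
    by (simp add: inner_sum_left)
  then show ?thesis by (simp add: sum_of_blocks)
qed

lemma block_block_sum:
  fixes blk :: "'m::finite \<Rightarrow> 'n::finite"
  shows "block blk i (block_sum blk S h) = (if i \<in> S then block blk i h else 0)"
  unfolding block_sum_def by (rule block_sum_of_blocks) simp

lemma block_block_scale:
  fixes blk :: "'m::finite \<Rightarrow> 'n::finite"
  shows "block blk i (block_scale blk u x) = u $ i *\<^sub>R block blk i x"
  using block_sum_of_blocks[of UNIV blk i "\<lambda>k. u $ k *\<^sub>R x"]
  by (simp add: block_scale_def block_linear)

lemma block_supported_mult:
  assumes "block_supported blk i A"
  shows "block blk i (A *v x) = A *v x"
proof -
  have "(A *v x) $ j = 0" if "blk j \<noteq> i" for j
    using assms that by (simp add: block_supported_def matrix_vector_mult_def)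
  then show ?thesis by (simp add: vec_eq_iff block_nth)
qed

lemma block_posdef_inner_commute:
  assumes "block_posdef blk i A"
  shows "(A *v x) \<bullet> y = (A *v y) \<bullet> x"
proof -
  have "(A *v x) \<bullet> y = (transpose A *v y) \<bullet> x"
    using dot_lmul_matrix[of y A x]
    by (simp add: inner_commute[of x] inner_commute[of "A *v x"])
  moreover have "transpose A = A" using assms by (simp add: block_posdef_def)
  ultimately show ?thesis by (simp only:)
qed

lemma block_norm_sq_nonneg:
  assumes "block_posdef blk i (B i)"
  shows "0 \<le> block_norm_sq blk B i x"
  using assms unfolding block_posdef_def block_norm_sq_def
  by (cases "block blk i x = 0") (auto intro: less_imp_le)

lemma block_norm_sq_diff:
  assumes "block_posdef blk i (B i)"
  shows "block_norm_sq blk B i (x - y) = block_norm_sq blk B i x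
    - 2 * ((B i *v block blk i y) \<bullet> block blk i x) + block_norm_sq blk B i y"
  using block_posdef_inner_commute[OF assms, of "block blk i x" "block blk i y"]
  unfolding block_norm_sq_def block_linear
  by (simp only: matrix_vector_mult_diff_distrib inner_diff_left inner_diff_right)

lemma weighted_norm_sq_nonneg:
  assumes "\<forall>i. block_posdef blk i (B i)" and "\<forall>i. 0 \<le> w $ i"
  shows "0 \<le> weighted_norm_sq blk B w x"
  unfolding weighted_norm_sq_def
  using assms by (intro sum_nonneg mult_nonneg_nonneg block_norm_sq_nonneg) auto

section \<open>The expected effect of one iteration\<close>

text \<open>The displacement of \<open>z\<close>, up to sign, in the iteration whose random set contains every
  block; a random step is the part of this vector on the drawn blocks.\<close>

definition alpha_direction ::
  "('m \<Rightarrow> 'n) \<Rightarrow> ('n \<Rightarrow> real^'m^'m) \<Rightarrow> real^'n \<Rightarrow> real^'n::finite \<Rightarrow> real \<Rightarrow> real^'m::finite \<Rightarrow> real^'m"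
  where
  "alpha_direction blk B p v t g =
     (\<Sum>i\<in>UNIV. (p $ i / (v $ i * t)) *\<^sub>R (block_inv blk i (B i) *v block blk i g))"

lemma block_alpha_direction:
  fixes blk :: "'m::finite \<Rightarrow> 'n::finite"
  assumes "\<forall>i. block_posdef blk i (B i)"
  shows "block blk i (alpha_direction blk B p v t g)
    = (p $ i / (v $ i * t)) *\<^sub>R (block_inv blk i (B i) *v block blk i g)"
proof -
  let ?u = "\<lambda>i. (p $ i / (v $ i * t)) *\<^sub>R (block_inv blk i (B i) *v block blk i g)"
  have u: "block blk i (?u i) = ?u i" for i
    unfolding block_linear
    by (simp only: block_supported_mult block_inv(1)[OF assms[rule_format]])
  have "alpha_direction blk B p v t g = (\<Sum>i\<in>UNIV. block blk i (?u i))"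
    by (simp only: u alpha_direction_def)
  then show ?thesis
    using block_sum_of_blocks[of UNIV blk i ?u] u by simp
qed

text \<open>The matrices \<open>B i\<close> turn the direction back into the rescaled gradient, so every
  quadratic term in \<open>d\<close> becomes a multiple of \<open>\<langle>g, d\<rangle>\<close>.\<close>

lemma mult_alpha_direction:
  fixes blk :: "'m::finite \<Rightarrow> 'n::finite"
  assumes "\<forall>i. block_posdef blk i (B i)"
  shows "B i *v block blk i (alpha_direction blk B p v t g) = (p $ i / (v $ i * t)) *\<^sub>R block blk i g"
proof -
  have "B i *v (block_inv blk i (B i) *v block blk i g) = block blk i g"
    using block_inv(2)[of blk i "B i"] assms
    by (simp add: matrix_vector_mul_assoc block_id_mult_vec block_block)
  then show ?thesis
    unfolding block_alpha_direction[OF assms] by (simp add: matrix_vector_mult_scaleR)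
qed

text \<open>The random set enters an iteration only through \<open>block_sum\<close>, which is the form of
  perturbation to which the ESO inequality applies.\<close>

lemma alpha_step_eq:
  fixes blk :: "'m::finite \<Rightarrow> 'n::finite" and x z :: "real^'m" and t :: real
    and f :: "real^'m \<Rightarrow> real" and p v :: "real^'n"
  assumes "\<forall>i. block_posdef blk i (B i)"
  defines "y \<equiv> (1 - t) *\<^sub>R x + t *\<^sub>R z"
  defines "d \<equiv> alpha_direction blk B p v t (gradient f y)"
  shows "alpha_step blk B f p v t S (x, z)
    = (y + block_sum blk S (- t *\<^sub>R block_scale blk (vec_powi p (-1)) d), z - block_sum blk S d)"
proof -
  define z' where "z' = (\<Sum>i\<in>UNIV. if i \<in> S
                 then block blk i z
                        - (p $ i / (v $ i * t)) *\<^sub>R (block_inv blk i (B i) *v block blk i (gradient f y))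
                 else block blk i z)"
  have "z' = (\<Sum>i\<in>UNIV. block blk i (z - block_sum blk S d))"
    unfolding z'_def
    by (rule sum.cong) (simp_all add: block_linear block_block_sum d_def block_alpha_direction assms(1))
  then have z': "z' = z - block_sum blk S d" by (simp add: sum_of_blocks)
  have x': "t *\<^sub>R block_scale blk (vec_powi p (-1)) (z' - z)
      = block_sum blk S (- t *\<^sub>R block_scale blk (vec_powi p (-1)) d)"
    by (rule eq_by_blocks[of blk]) (simp add: z' block_linear block_block_sum block_block_scale)
  show ?thesis
    unfolding alpha_step_def Let_def prod.case y_def[symmetric] z'_def[symmetric] x'
    by (simp add: z')
qed

lemma expectation_sampling_if:
  fixes Shat :: "'n::finite set pmf"
  shows "measure_pmf.expectation Shat (\<lambda>S. if i \<in> S then a else b)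
    = sampling_prob Shat $ i * a + (1 - sampling_prob Shat $ i) * (b::real)"
proof -
  have "measure_pmf.expectation Shat (\<lambda>S. if i \<in> S then a else b)
      = measure_pmf.expectation Shat (\<lambda>S. b + (a - b) * indicator {A. i \<in> A} S)"
    by (intro Bochner_Integration.integral_cong) (auto simp: indicator_def)
  also have "\<dots> = b + (a - b) * measure_pmf.prob Shat {A. i \<in> A}"
    by (subst Bochner_Integration.integral_add) (auto intro!: integrable_measure_pmf_finite)
  finally show ?thesis by (simp add: sampling_prob_def algebra_simps)
qed

text \<open>
  With \<open>g\<close> and \<open>d\<close> the gradient and the direction of the step, the ESO bound on \<open>f x'\<close> contributes \<open>- t/2 \<langle>g, d\<rangle>\<close> and the exact
  expectation of \<open>t\<^sup>2/2 N (z' - u)\<close> contributes \<open>t/2 \<langle>g, d\<rangle>\<close>; after the cancellation only the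
  linear term \<open>t \<langle>g, u - z\<rangle>\<close> remains, which convexity turns into function values.
\<close>

lemma alpha_step_expected_decrease:
  fixes blk :: "'m::finite \<Rightarrow> 'n::finite"
  assumes B: "\<forall>i. block_posdef blk i (B i)"
    and f: "convex_on UNIV f" "\<forall>x. f differentiable at x"
    and proper: "proper_sampling Shat"
    and v: "\<forall>i. v $ i > 0"
    and eso: "ESO blk B f Shat v"
    and t: "0 < t" "t \<le> 1"
  defines "p \<equiv> sampling_prob Shat"
  defines "N \<equiv> weighted_norm_sq blk B (v * vec_powi p (-2))"
  shows "measure_pmf.expectation Shat
      (\<lambda>S. case alpha_step blk B f p v t S (x, z) of (x', z') \<Rightarrow> f x' + t\<^sup>2 / 2 * N (z' - u))
    \<le> (1 - t) * f x + t * f u + t\<^sup>2 / 2 * N (z - u)"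
proof -
  define y where "y = (1 - t) *\<^sub>R x + t *\<^sub>R z"
  define g where "g = gradient f y"
  define d where "d = alpha_direction blk B p v t g"
  define h where "h = - t *\<^sub>R block_scale blk (vec_powi p (-1)) d"
  have p: "p $ i > 0" for i using proper by (simp add: proper_sampling_def p_def)
  have v': "v $ i > 0" for i using v by simp
  have step: "alpha_step blk B f p v t S (x, z) = (y + block_sum blk S h, z - block_sum blk S d)" for S
    using alpha_step_eq[OF B, of f p v t S x z] by (simp add: y_def g_def d_def h_def)
  have h: "block blk i h = - (t / p $ i) *\<^sub>R block blk i d" for i
    by (simp add: h_def block_linear block_block_scale vec_powi_def power_int_minus divide_inverse)
  have Bd: "B i *v block blk i d = (p $ i / (v $ i * t)) *\<^sub>R block blk i g" for i
    unfolding d_def by (rule mult_alpha_direction[OF B])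
  have norm_d: "block_norm_sq blk B i d = p $ i / (v $ i * t) * (block blk i g \<bullet> block blk i d)" for i
    by (simp add: block_norm_sq_def Bd)

  have "measure_pmf.expectation Shat (\<lambda>S. f (y + block_sum blk S h))
      \<le> f y + weighted_inner blk p g h + 1/2 * weighted_norm_sq blk B (v * p) h"
    using eso by (simp add: ESO_def p_def g_def)
  also have "weighted_inner blk p g h = - t * (g \<bullet> d)"
    unfolding weighted_inner_def h inner_by_blocks[of blk g d, symmetric] sum_distrib_left
    by (rule sum.cong) (use p in \<open>auto simp: less_imp_neq[THEN not_sym]\<close>)
  also have "weighted_norm_sq blk B (v * p) h = t * (g \<bullet> d)"
    unfolding weighted_norm_sq_def inner_by_blocks[of blk g d, symmetric] sum_distrib_left
  proof (rule sum.cong)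
    fix i
    have "block_norm_sq blk B i h = (t / p $ i)\<^sup>2 * block_norm_sq blk B i d"
      unfolding block_norm_sq_def h matrix_vector_mult_scaleR
      by (simp add: power2_eq_square)
    then show "(v * p) $ i * block_norm_sq blk B i h = t * (block blk i g \<bullet> block blk i d)"
      using p[of i] v'[of i] t by (simp add: norm_d power2_eq_square field_simps)
  qed simp
  finally have Ef: "measure_pmf.expectation Shat (\<lambda>S. f (y + block_sum blk S h)) \<le> f y - t / 2 * (g \<bullet> d)"
    by simp

  (* The norm is additive over blocks, so only the marginals p $ i of the sampling matter here. *)
  have "N (z - block_sum blk S d - u)
      = (\<Sum>i\<in>UNIV. if i \<in> S then v $ i / (p $ i)\<^sup>2 * block_norm_sq blk B i ((z - u) - d)
                   else v $ i / (p $ i)\<^sup>2 * block_norm_sq blk B i (z - u))" for S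
    unfolding N_def weighted_norm_sq_def
    by (rule sum.cong)
      (auto simp: block_norm_sq_def block_linear block_block_sum vec_powi_def power_int_minus
        divide_inverse algebra_simps)
  then have "measure_pmf.expectation Shat (\<lambda>S. N (z - block_sum blk S d - u))
     = (\<Sum>i\<in>UNIV. measure_pmf.expectation Shat (\<lambda>S.
         if i \<in> S then v $ i / (p $ i)\<^sup>2 * block_norm_sq blk B i ((z - u) - d)
                   else v $ i / (p $ i)\<^sup>2 * block_norm_sq blk B i (z - u)))"
    by (simp add: Bochner_Integration.integral_sum integrable_measure_pmf_finite)
  also have "\<dots> = (\<Sum>i\<in>UNIV. v $ i / (p $ i)\<^sup>2 * block_norm_sq blk B i (z - u)
      + (1 / t) * (block blk i g \<bullet> block blk i d) - (2 / t) * (block blk i g \<bullet> block blk i (z - u)))"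
  proof (rule sum.cong)
    fix i
    show "measure_pmf.expectation Shat (\<lambda>S.
         if i \<in> S then v $ i / (p $ i)\<^sup>2 * block_norm_sq blk B i ((z - u) - d)
                   else v $ i / (p $ i)\<^sup>2 * block_norm_sq blk B i (z - u))
      = v $ i / (p $ i)\<^sup>2 * block_norm_sq blk B i (z - u)
      + (1 / t) * (block blk i g \<bullet> block blk i d) - (2 / t) * (block blk i g \<bullet> block blk i (z - u))"
      unfolding expectation_sampling_if p_def[symmetric] block_norm_sq_diff[OF B[rule_format]] Bd norm_d
      using p[of i] v'[of i] t by (simp add: power2_eq_square field_simps)
  qed simp
  also have "\<dots> = N (z - u) + (1 / t) * (g \<bullet> d) - (2 / t) * (g \<bullet> (z - u))"
    unfolding inner_by_blocks[of blk g d, symmetric] inner_by_blocks[of blk g "z - u", symmetric]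
      N_def weighted_norm_sq_def
    by (simp add: sum.distrib sum_subtractf sum_distrib_left vec_powi_def power_int_minus divide_inverse)
  finally have EN: "t\<^sup>2 / 2 * measure_pmf.expectation Shat (\<lambda>S. N (z - block_sum blk S d - u))
     = t\<^sup>2 / 2 * N (z - u) + t / 2 * (g \<bullet> d) - t * (g \<bullet> (z - u))"
    using t by (simp add: power2_eq_square field_simps)

  (* The definition of y makes t (u - z) a combination of the directions from y to u and to x. *)
  have "t *\<^sub>R (u - z) = t *\<^sub>R (u - y) + (1 - t) *\<^sub>R (x - y)"
    by (simp add: y_def algebra_simps)
  then have "t * (g \<bullet> (u - z)) = t * (g \<bullet> (u - y)) + (1 - t) * (g \<bullet> (x - y))"
    by (metis inner_add_right inner_scaleR_right)
  moreover have "t * (f y + g \<bullet> (u - y)) \<le> t * f u"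
    using convex_above_gradient[OF f(1), of y u] f(2) t by (simp add: g_def)
  moreover have "(1 - t) * (f y + g \<bullet> (x - y)) \<le> (1 - t) * f x"
    using convex_above_gradient[OF f(1), of y x] f(2) t by (simp add: g_def mult_left_mono)
  ultimately have conv: "f y + t * (g \<bullet> (u - z)) \<le> (1 - t) * f x + t * f u"
    by (simp add: algebra_simps)

  have "measure_pmf.expectation Shat
      (\<lambda>S. case alpha_step blk B f p v t S (x, z) of (x', z') \<Rightarrow> f x' + t\<^sup>2 / 2 * N (z' - u))
    = measure_pmf.expectation Shat (\<lambda>S. f (y + block_sum blk S h))
      + t\<^sup>2 / 2 * measure_pmf.expectation Shat (\<lambda>S. N (z - block_sum blk S d - u))"
    by (simp add: step Bochner_Integration.integral_add integrable_measure_pmf_finite)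
  also have "\<dots> \<le> f y + t * (g \<bullet> (u - z)) + t\<^sup>2 / 2 * N (z - u)"
    using Ef unfolding EN by (simp add: inner_diff_right algebra_simps)
  finally show ?thesis using conv by simp
qed

section \<open>Conditioning on the past\<close>

lemma (in prob_space) integrable_finite_valued:
  fixes g :: "'b \<Rightarrow> real"
  assumes "finite K" and "X \<in> measurable M (count_space K)"
  shows "integrable M (\<lambda>\<omega>. g (X \<omega>))"
proof (rule integrable_const_bound)
  show "AE \<omega> in M. norm (g (X \<omega>)) \<le> (\<Sum>a\<in>K. \<bar>g a\<bar>)"
    using measurable_space[OF assms(2)] assms(1)
    by (intro AE_I2) (auto intro!: member_le_sum[of _ K "\<lambda>a. \<bar>g a\<bar>"])
  show "(\<lambda>\<omega>. g (X \<omega>)) \<in> borel_measurable M"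
    using assms(2) by (rule measurable_compose) simp
qed

text \<open>
  Integrating out an independent variable of finite type: \<open>g (X, Y)\<close> is the sum over the values
  \<open>b\<close> of \<open>Y\<close> of \<open>g (X, b)\<close> times the indicator of \<open>Y = b\<close>, and the expectation of each product
  factorizes. The independent variable has the form \<open>\<phi> \<circ> Z\<close> because \<open>indep_var\<close> relates variables
  of the same type, whereas the past is a function on time steps and \<open>Y\<close> is a single value.
\<close>

lemma (in prob_space) expectation_indep_pmf:
  fixes D :: "'b::finite pmf" and g :: "'c \<Rightarrow> 'b \<Rightarrow> real" and X Z :: "'a \<Rightarrow> 'c"
  assumes fin: "finite K"
    and indep: "indep_var (count_space K) X N Z"
    and \<phi>: "\<phi> \<in> measurable N (count_space UNIV)"
    and D: "distr M (count_space UNIV) (\<lambda>\<omega>. \<phi> (Z \<omega>)) = measure_pmf D"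
  shows "(LINT \<omega>|M. g (X \<omega>) (\<phi> (Z \<omega>))) = (LINT \<omega>|M. measure_pmf.expectation D (g (X \<omega>)))"
proof -
  define Y where "Y \<omega> = \<phi> (Z \<omega>)" for \<omega>
  have X_meas: "X \<in> measurable M (count_space K)" and Z_meas: "Z \<in> measurable M N"
    using indep by (auto dest: indep_var_rv1 indep_var_rv2)
  have Y_meas: "Y \<in> measurable M (count_space UNIV)"
    unfolding Y_def using Z_meas \<phi> by (rule measurable_compose)
  have summand: "(LINT \<omega>|M. g (X \<omega>) b * indicator {b} (Y \<omega>)) = (LINT \<omega>|M. pmf D b * g (X \<omega>) b)"
    "integrable M (\<lambda>\<omega>. g (X \<omega>) b * indicator {b} (Y \<omega>))" for b
  proof -
    have "(indicator {b} \<circ> \<phi> :: 'c \<Rightarrow> real) \<in> borel_measurable N"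
      using \<phi> by (auto simp: comp_def intro: measurable_compose)
    then have ind: "indep_var borel (\<lambda>\<omega>. g (X \<omega>) b) borel (\<lambda>\<omega>. indicator {b} (Y \<omega>))"
      using indep_var_compose[OF indep, of "\<lambda>a. g a b" borel "indicator {b} \<circ> \<phi>" borel]
      by (simp add: comp_def Y_def)
    have int: "integrable M (\<lambda>\<omega>. g (X \<omega>) b)" "integrable M (\<lambda>\<omega>. indicator {b} (Y \<omega>) :: real)"
      using integrable_finite_valued[OF fin X_meas, of "\<lambda>a. g a b"]
        integrable_finite_valued[OF _ Y_meas, of "indicator {b}"] by simp_all
    have "(LINT \<omega>|M. indicator {b} (Y \<omega>) :: real) = pmf D b"
      using integral_distr[OF Y_meas, of "indicator {b} :: 'b \<Rightarrow> real"] D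
      by (simp add: measure_pmf_single Y_def[abs_def])
    then show "(LINT \<omega>|M. g (X \<omega>) b * indicator {b} (Y \<omega>)) = (LINT \<omega>|M. pmf D b * g (X \<omega>) b)"
      using indep_var_lebesgue_integral[OF ind int] by simp
    show "integrable M (\<lambda>\<omega>. g (X \<omega>) b * indicator {b} (Y \<omega>))"
      by (rule indep_var_integrable[OF ind int])
  qed
  have "(LINT \<omega>|M. g (X \<omega>) (Y \<omega>)) = (LINT \<omega>|M. (\<Sum>b\<in>UNIV. g (X \<omega>) b * indicator {b} (Y \<omega>)))"
    by (simp add: indicator_def)
  also have "\<dots> = (\<Sum>b\<in>UNIV. LINT \<omega>|M. pmf D b * g (X \<omega>) b)"
    by (subst Bochner_Integration.integral_sum) (simp_all only: summand)
  also have "\<dots> = (LINT \<omega>|M. (\<Sum>b\<in>UNIV. pmf D b * g (X \<omega>) b))"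
    by (rule Bochner_Integration.integral_sum[symmetric])
      (rule integrable_finite_valued[OF fin X_meas, of "\<lambda>a. pmf D b * g a b" for b])
  also have "\<dots> = (LINT \<omega>|M. measure_pmf.expectation D (g (X \<omega>)))"
    by (simp add: integral_measure_pmf[of UNIV])
  finally show ?thesis by (simp add: Y_def)
qed

text \<open>Depending only on the sets drawn before time \<open>k\<close>, the state at time \<open>k\<close> takes finitely many
  values and is independent of the set drawn next.\<close>

lemma alpha_state_cong:
  assumes "\<And>j. j < k \<Longrightarrow> S j = S' j"
  shows "alpha_state blk B f p v \<theta> x0 S k = alpha_state blk B f p v \<theta> x0 S' k"
  using assms by (induction k) simp_all

lemma alpha_state_restrict:
  "alpha_state blk B f p v \<theta> x0 (restrict S {..<k}) k = alpha_state blk B f p v \<theta> x0 S k"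
  by (rule alpha_state_cong) simp

lemma (in prob_space) integrable_alpha_state:
  fixes S :: "nat \<Rightarrow> 'a \<Rightarrow> 'n::finite set" and \<Phi> :: "_ \<Rightarrow> real"
  assumes "indep_vars (\<lambda>_. count_space UNIV) S UNIV"
  shows "integrable M (\<lambda>\<omega>. \<Phi> (alpha_state blk B f p v \<theta> x0 (\<lambda>j. S j \<omega>) k))"
proof -
  have "(\<lambda>\<omega>. \<lambda>j\<in>{..<k}. S j \<omega>) \<in> measurable M (PiM {..<k} (\<lambda>_. count_space UNIV))"
    using assms by (intro measurable_restrict) (simp add: indep_vars_def)
  also have "PiM {..<k} (\<lambda>_. count_space UNIV) = count_space (PiE {..<k} (\<lambda>_. UNIV :: 'n set set))"
    by (rule count_space_PiM_finite) simp_all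
  finally show ?thesis
    using integrable_finite_valued[of "PiE {..<k} (\<lambda>_. UNIV :: 'n set set)"
      "\<lambda>\<omega>. \<lambda>j\<in>{..<k}. S j \<omega>" "\<lambda>s. \<Phi> (alpha_state blk B f p v \<theta> x0 s k)"]
    by (simp add: finite_PiE alpha_state_restrict del: restrict_apply)
qed

lemma (in prob_space) expectation_alpha_state_Suc:
  fixes S :: "nat \<Rightarrow> 'a \<Rightarrow> 'n::finite set" and \<Phi> :: "_ \<Rightarrow> real"
  assumes indep: "indep_vars (\<lambda>_. count_space UNIV) S UNIV"
    and S: "\<forall>k. distr M (count_space UNIV) (S k) = measure_pmf Shat"
  shows "(LINT \<omega>|M. \<Phi> (alpha_state blk B f p v \<theta> x0 (\<lambda>j. S j \<omega>) (Suc k)))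
    = (LINT \<omega>|M. measure_pmf.expectation Shat
        (\<lambda>A. \<Phi> (alpha_step blk B f p v (\<theta> k) A (alpha_state blk B f p v \<theta> x0 (\<lambda>j. S j \<omega>) k))))"
proof -
  have PiM: "PiM {..<k} (\<lambda>_. count_space UNIV) = count_space (PiE {..<k} (\<lambda>_. UNIV :: 'n set set))"
    by (rule count_space_PiM_finite) simp_all
  have "indep_var (PiM {..<k} (\<lambda>_. count_space UNIV)) (\<lambda>\<omega>. \<lambda>j\<in>{..<k}. S j \<omega>)
          (PiM {k} (\<lambda>_. count_space UNIV)) (\<lambda>\<omega>. \<lambda>j\<in>{k}. S j \<omega>)"
    by (rule indep_var_restrict[OF indep]) auto
  then have "indep_var (count_space (PiE {..<k} (\<lambda>_. UNIV))) (\<lambda>\<omega>. \<lambda>j\<in>{..<k}. S j \<omega>)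
          (PiM {k} (\<lambda>_. count_space UNIV)) (\<lambda>\<omega>. \<lambda>j\<in>{k}. S j \<omega>)"
    by (simp only: PiM)
  moreover have "(\<lambda>s. s k) \<in> measurable (PiM {k} (\<lambda>_. count_space UNIV)) (count_space (UNIV :: 'n set set))"
    by (rule measurable_component_singleton) simp
  moreover have "distr M (count_space UNIV) (\<lambda>\<omega>. (\<lambda>j\<in>{k}. S j \<omega>) k) = measure_pmf Shat"
    using S by simp
  ultimately have mean: "(LINT \<omega>|M. g (\<lambda>j\<in>{..<k}. S j \<omega>) ((\<lambda>j\<in>{k}. S j \<omega>) k))
      = (LINT \<omega>|M. measure_pmf.expectation Shat (g (\<lambda>j\<in>{..<k}. S j \<omega>)))"
    for g :: "(nat \<Rightarrow> 'n set) \<Rightarrow> 'n set \<Rightarrow> real"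
    by (intro expectation_indep_pmf[where K = "PiE {..<k} (\<lambda>_. UNIV)"
          and N = "PiM {k} (\<lambda>_. count_space UNIV)" and \<phi> = "\<lambda>s. s k"])
      (simp_all only: finite_PiE finite_lessThan finite)
  from mean[of "\<lambda>s A. \<Phi> (alpha_step blk B f p v (\<theta> k) A (alpha_state blk B f p v \<theta> x0 s k))"]
  show ?thesis by (simp add: alpha_state_restrict)
qed

section \<open>The stepsize sequence\<close>

text \<open>
  The new stepsize \<open>b\<close> is the positive root of \<open>b\<^sup>2 = (1 - b) a\<^sup>2\<close>. In terms of reciprocals this
  reads \<open>(1/b - 1/2)\<^sup>2 = 1/a\<^sup>2 + 1/4\<close>, so \<open>1/b\<close> exceeds \<open>1/a\<close> by at least \<open>1/2\<close>.
\<close>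

lemma stepsize_recurrence:
  fixes a b :: real
  assumes a: "0 < a" "a \<le> 1" and b: "b = (sqrt (a ^ 4 + 4 * a\<^sup>2) - a\<^sup>2) / 2"
  shows "0 < b" and "b \<le> 1" and "(1 - b) / b\<^sup>2 = 1 / a\<^sup>2" and "1 / a + 1 / 2 \<le> 1 / b"
proof -
  have r: "b\<^sup>2 = (1 - b) * a\<^sup>2"
  proof -
    have "2 * b + a\<^sup>2 = sqrt (a ^ 4 + 4 * a\<^sup>2)"
      using b by simp
    then have "(2 * b + a\<^sup>2)\<^sup>2 = a ^ 4 + 4 * a\<^sup>2"
      by simp
    then show ?thesis by (simp add: power2_eq_square power4_eq_xxxx algebra_simps)
  qed
  have "a\<^sup>2 < sqrt (a ^ 4 + 4 * a\<^sup>2)"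
    using a by (intro real_less_rsqrt) (simp add: power2_eq_square power4_eq_xxxx)
  then show b0: "0 < b" using b by simp
  then have "0 < (1 - b) * a\<^sup>2" unfolding r[symmetric] by simp
  then show "b \<le> 1" using a by (simp add: zero_less_mult_iff)
  show q: "(1 - b) / b\<^sup>2 = 1 / a\<^sup>2"
    using r a b0 by (simp add: field_simps)
  have "(1 / a)\<^sup>2 \<le> (1 / b - 1 / 2)\<^sup>2"
  proof -
    have "1 / b\<^sup>2 - 1 / b = (1 / a)\<^sup>2"
      using q b0 by (simp add: power2_eq_square diff_divide_distrib)
    then show ?thesis by (simp add: power2_eq_square algebra_simps)
  qed
  moreover have "0 \<le> 1 / b - 1 / 2"
    using b0 \<open>b \<le> 1\<close> by (simp add: field_simps)
  ultimately have "1 / a \<le> 1 / b - 1 / 2" by (rule power2_le_imp_le)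
  then show "1 / a + 1 / 2 \<le> 1 / b" by simp
qed

section \<open>The convergence rate\<close>

theorem theorem2:
  fixes blk :: "'m::finite \<Rightarrow> 'n::finite"
    and B :: "'n \<Rightarrow> real^'m^'m"
    and f :: "real^'m \<Rightarrow> real"
    and Shat :: "'n set pmf"
    and p v :: "real^'n"
    and \<theta> :: "nat \<Rightarrow> real"
    and x0 :: "real^'m"
    and C :: "real^'m \<Rightarrow> real"
    and M :: "'w measure"
    and S :: "nat \<Rightarrow> 'w \<Rightarrow> 'n set"
  assumes "surj blk"
    and "\<forall>i. block_posdef blk i (B i)"
    and "convex_on UNIV f"
    and "\<forall>x. f differentiable at x"
    and "proper_sampling Shat"
    and "p = sampling_prob Shat"
    and "\<forall>i. v $ i > 0"
    and "ESO blk B f Shat v"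
    and "0 < \<theta> 0" and "\<theta> 0 \<le> 1"
    and "\<forall>k. \<theta> (Suc k) = (sqrt (\<theta> k ^ 4 + 4 * \<theta> k ^ 2) - \<theta> k ^ 2) / 2"
    and "\<forall>y. C y = (1 - \<theta> 0) * (f x0 - f y)
                    + \<theta> 0 ^ 2 / 2 * weighted_norm_sq blk B (v * vec_powi p (-2)) (x0 - y)"
    and "prob_space M"
    and "prob_space.indep_vars M (\<lambda>_. count_space UNIV) S UNIV"
    and "\<forall>k. distr M (count_space UNIV) (S k) = measure_pmf Shat"
  shows "(\<forall>y. C y \<ge> 0 \<longrightarrow> (\<forall>k\<ge>1.
            (LINT \<omega>|M. f (alpha_x blk B f p v \<theta> x0 (\<lambda>j. S j \<omega>) k)) - f y
              \<le> 4 * C y / ((real k - 1) * \<theta> 0 + 2) ^ 2))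
       \<and> (\<theta> 0 = 1 \<longrightarrow> (\<forall>y. \<forall>k\<ge>1.
            (LINT \<omega>|M. f (alpha_x blk B f p v \<theta> x0 (\<lambda>j. S j \<omega>) k)) - f y
              \<le> 2 * weighted_norm_sq blk B (v * vec_powi p (-2)) (x0 - y) / (real k + 1) ^ 2
            \<and> 2 * weighted_norm_sq blk B (v * vec_powi p (-2)) (x0 - y) / (real k + 1) ^ 2
              = 2 * (\<Sum>i\<in>UNIV. v $ i / (p $ i) ^ 2 * block_norm_sq blk B i (x0 - y)) / (real k + 1) ^ 2))"
proof -
  interpret prob_space M by fact
  define N where "N = weighted_norm_sq blk B (v * vec_powi p (-2))"
  define st where "st k \<omega> = alpha_state blk B f p v \<theta> x0 (\<lambda>j. S j \<omega>) k" for k \<omega>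
  define \<Psi> where "\<Psi> y k = (\<lambda>(x, z). (1 - \<theta> k) / (\<theta> k)\<^sup>2 * (f x - f y) + N (z - y) / 2)"
    for y and k :: nat
  have N_nonneg: "0 \<le> N u" for u
    unfolding N_def using assms(2,7)
    by (intro weighted_norm_sq_nonneg) (auto simp: vec_powi_def less_imp_le power_int_minus)
  have N_eq: "N u = (\<Sum>i\<in>UNIV. v $ i / (p $ i)\<^sup>2 * block_norm_sq blk B i u)" for u
    unfolding N_def weighted_norm_sq_def
    by (rule sum.cong) (simp_all add: vec_powi_def power_int_minus divide_inverse)

  have theta: "0 < \<theta> k \<and> \<theta> k \<le> 1 \<and> 1 / \<theta> 0 + real k / 2 \<le> 1 / \<theta> k" for k
  proof (induction k)
    case 0
    then show ?case using assms(9,10) by simp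
  next
    case (Suc k)
    have "\<theta> (Suc k) = (sqrt (\<theta> k ^ 4 + 4 * (\<theta> k)\<^sup>2) - (\<theta> k)\<^sup>2) / 2"
      using assms(11) by blast
    from stepsize_recurrence(1,2,4)[OF _ _ this] Suc.IH show ?case
      by (auto simp: add_divide_distrib)
  qed
  have theta_Suc: "(1 - \<theta> (Suc k)) / (\<theta> (Suc k))\<^sup>2 = 1 / (\<theta> k)\<^sup>2" for k
    using stepsize_recurrence(3)[of "\<theta> k" "\<theta> (Suc k)"] theta[of k] assms(11) by blast

  have integrable: "integrable M (\<lambda>\<omega>. \<Phi> (st k \<omega>))" for \<Phi> :: "_ \<Rightarrow> real" and k
    unfolding st_def by (rule integrable_alpha_state[OF assms(14)])

  have descent: "(LINT \<omega>|M. \<Psi> y (Suc k) (st (Suc k) \<omega>)) \<le> (LINT \<omega>|M. \<Psi> y k (st k \<omega>))" for y k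
  proof -
    have "measure_pmf.expectation Shat (\<lambda>A. \<Psi> y (Suc k) (alpha_step blk B f p v (\<theta> k) A (x, z)))
        \<le> \<Psi> y k (x, z)" for x z
    proof -
      let ?F = "\<lambda>A. case alpha_step blk B f p v (\<theta> k) A (x, z) of
                  (x', z') \<Rightarrow> f x' + (\<theta> k)\<^sup>2 / 2 * N (z' - y)"
      have t: "0 < \<theta> k" "\<theta> k \<le> 1" using theta[of k] by auto
      have "\<Psi> y (Suc k) (alpha_step blk B f p v (\<theta> k) A (x, z)) = 1 / (\<theta> k)\<^sup>2 * (?F A - f y)" for A
        using t by (simp add: \<Psi>_def theta_Suc field_simps split: prod.split)
      then have "measure_pmf.expectation Shat (\<lambda>A. \<Psi> y (Suc k) (alpha_step blk B f p v (\<theta> k) A (x, z)))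
          = 1 / (\<theta> k)\<^sup>2 * (measure_pmf.expectation Shat ?F - f y)"
        by (simp add: Bochner_Integration.integral_diff integrable_measure_pmf_finite)
      also have "\<dots> \<le> 1 / (\<theta> k)\<^sup>2
          * ((1 - \<theta> k) * f x + \<theta> k * f y + (\<theta> k)\<^sup>2 / 2 * N (z - y) - f y)"
        using alpha_step_expected_decrease[OF assms(2,3,4,5,7,8) t, where x = x and z = z and u = y]
        unfolding N_def assms(6) by (intro mult_left_mono diff_right_mono) auto
      also have "\<dots> = \<Psi> y k (x, z)"
        using t by (simp add: \<Psi>_def field_simps)
      finally show ?thesis .
    qed
    then have "measure_pmf.expectation Shat (\<lambda>A. \<Psi> y (Suc k) (alpha_step blk B f p v (\<theta> k) A s))
        \<le> \<Psi> y k s" for s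
      by (cases s) blast
    then have "(LINT \<omega>|M. measure_pmf.expectation Shat
          (\<lambda>A. \<Psi> y (Suc k) (alpha_step blk B f p v (\<theta> k) A (st k \<omega>)))) \<le> (LINT \<omega>|M. \<Psi> y k (st k \<omega>))"
      by (intro integral_mono
        integrable[of "\<lambda>s. measure_pmf.expectation Shat (\<lambda>A. \<Psi> y (Suc k) (alpha_step blk B f p v (\<theta> k) A s))"]
        integrable)
    then show ?thesis
      unfolding st_def expectation_alpha_state_Suc[OF assms(14,15)] .
  qed
  have start: "(LINT \<omega>|M. \<Psi> y 0 (st 0 \<omega>)) = C y / (\<theta> 0)\<^sup>2" for y
  proof -
    have "C y = (1 - \<theta> 0) * (f x0 - f y) + (\<theta> 0)\<^sup>2 / 2 * N (x0 - y)"
      using assms(12) unfolding N_def by blast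
    then show ?thesis
      using assms(9) by (simp add: st_def \<Psi>_def prob_space add_divide_distrib)
  qed
  have potential: "(LINT \<omega>|M. \<Psi> y k (st k \<omega>)) \<le> C y / (\<theta> 0)\<^sup>2" for y k
  proof (induction k)
    case 0
    show ?case by (simp only: start)
  next
    case (Suc k)
    show ?case using descent Suc.IH by (rule order_trans)
  qed

  have rate: "(LINT \<omega>|M. f (alpha_x blk B f p v \<theta> x0 (\<lambda>j. S j \<omega>) k)) - f y
      \<le> 4 * C y / ((real k - 1) * \<theta> 0 + 2) ^ 2"
    if "0 \<le> C y" "1 \<le> k" for y k
  proof -
    obtain m where k: "k = Suc m" using \<open>1 \<le> k\<close> by (cases k) auto
    let ?E = "LINT \<omega>|M. f (fst (st k \<omega>))"
    have t: "0 < \<theta> m" and inv: "1 / \<theta> 0 + real m / 2 \<le> 1 / \<theta> m" using theta[of m] by auto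
    have "1 / (\<theta> m)\<^sup>2 * (?E - f y) = (LINT \<omega>|M. 1 / (\<theta> m)\<^sup>2 * (f (fst (st k \<omega>)) - f y))"
      using integrable[of "\<lambda>s. f (fst s)" k] by (simp add: prob_space)
    (* Drop the nonnegative distance term of the potential at time Suc m; its other coefficient
       is 1 / (\<theta> m)\<^sup>2, which is why the stepsize in the bound has index k - 1. *)
    also have "\<dots> \<le> (LINT \<omega>|M. \<Psi> y k (st k \<omega>))"
    proof (intro integral_mono)
      show "integrable M (\<lambda>\<omega>. 1 / (\<theta> m)\<^sup>2 * (f (fst (st k \<omega>)) - f y))"
        by (rule integrable[of "\<lambda>s. 1 / (\<theta> m)\<^sup>2 * (f (fst s) - f y)"])
      show "1 / (\<theta> m)\<^sup>2 * (f (fst (st k \<omega>)) - f y) \<le> \<Psi> y k (st k \<omega>)" for \<omega>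
        using N_nonneg by (simp add: \<Psi>_def k theta_Suc split: prod.split)
    qed (rule integrable)
    also have "\<dots> \<le> C y / (\<theta> 0)\<^sup>2" by (rule potential)
    finally have "?E - f y \<le> C y * (\<theta> m / \<theta> 0)\<^sup>2"
      using t by (simp add: field_simps)
    also have "\<dots> \<le> C y * (2 / (real m * \<theta> 0 + 2))\<^sup>2"
    proof (intro mult_left_mono power_mono)
      show "\<theta> m / \<theta> 0 \<le> 2 / (real m * \<theta> 0 + 2)"
        using inv t assms(9) by (simp add: field_simps add_pos_nonneg)
    qed (use that t assms(9) in auto)
    also have "\<dots> = 4 * C y / ((real k - 1) * \<theta> 0 + 2) ^ 2"
      by (simp add: k power_divide)
    finally show ?thesis by (simp add: st_def alpha_x_def)
  qed

  have "(LINT \<omega>|M. f (alpha_x blk B f p v \<theta> x0 (\<lambda>j. S j \<omega>) k)) - f y \<le> 2 * N (x0 - y) / (real k + 1) ^ 2"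
    if "\<theta> 0 = 1" "1 \<le> k" for y k
  proof -
    have C: "C y = N (x0 - y) / 2" using assms(12) that by (simp add: N_def)
    then have "0 \<le> C y" using N_nonneg[of "x0 - y"] by linarith
    from rate[OF this \<open>1 \<le> k\<close>] show ?thesis by (simp add: C that add.commute)
  qed
  then show ?thesis
    using rate N_eq by (simp add: N_def)
qed

end
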